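(* Let $k$ be a positive integer, let $(a_n)_{n\ge 0}$ and $(b_n)_{n\ge 0}$ be real sequences, and let $(\eta_n)_{n\ge -4k+1}$ be a well-defined real solution of $$\eta_{n+1}=\frac{\eta_{n-4k+1}}{a_n+b_n\prod_{i=1}^{k}\eta_{n-4i+1}},\qquad n\ge 0,$$ with initial values $\eta_{-4k+1},\eta_{-4k+2},\dots,\eta_0$. Then for all integers $n\ge 0$ and all $i=0,1,\dots,4k-1$, $$\eta_{4kn-4k+1+i}=\eta_{i-4k+1}\prod_{s=0}^{n-1}\frac{\left(\prod_{k_1=0}^{ks+\lfloor i/4\rfloor-1}a_{4k_1+\tau(i)}\right)+\left(\prod_{j=0}^{k-1}\eta_{\tau(i)-4k+1+4j}\right)\sum_{l=0}^{ks+\lfloor i/4\rfloor-1}\left(b_{4l+\tau(i)}\prod_{k_2=l+1}^{ks+\lfloor i/4\rfloor-1}a_{4k_2+\tau(i)}\right)}{\left(\prod_{k_1=0}^{ks+\lfloor i/4\rfloor}a_{4k_1+\tau(i)}\right)+\left(\prod_{j=0}^{k-1}\eta_{\tau(i)-4k+1+4j}\right)\sum_{l=0}^{ks+\lfloor i/4\rfloor}\left(b_{4l+\tau(i)}\prod_{k_2=l+1}^{ks+\lfloor i/4\rfloor}a_{4k_2+\tau(i)}\right)}.$$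
   Context: For an integer $r\ge 0$, $\tau(r)\in\{0,1,2,3\}$ denotes the remainder of $r$ on division by $4$, so $r=4\lfloor r/4\rfloor+\tau(r)$. Empty products equal $1$ and empty sums equal $0$. A solution is well-defined if every denominator $a_n+b_n\prod_{i=1}^{k}\eta_{n-4i+1}$, $n\ge 0$, is non-zero. *)

theory Defs
  imports Complex_Main
begin

definition tau :: "nat \<Rightarrow> nat" where
  "tau r = r mod 4"

text \<open>
  A sequence with index set \<open>{-4k+1, -4k+2, ...}\<close> is a function on \<open>int\<close>; its values below
  \<open>-4k+1\<close> are arbitrary and are never accessed.
\<close>

definition denom :: "nat \<Rightarrow> (nat \<Rightarrow> real) \<Rightarrow> (nat \<Rightarrow> real) \<Rightarrow> (int \<Rightarrow> real) \<Rightarrow> nat \<Rightarrow> real" where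
  "denom k a b \<eta> n = a n + b n * (\<Prod>i = 1..k. \<eta> (int n - 4 * int i + 1))"

definition is_solution :: "nat \<Rightarrow> (nat \<Rightarrow> real) \<Rightarrow> (nat \<Rightarrow> real) \<Rightarrow> (int \<Rightarrow> real) \<Rightarrow> bool" where
  "is_solution k a b \<eta> \<longleftrightarrow>
     (\<forall>n. \<eta> (int n + 1) = \<eta> (int n - 4 * int k + 1) / denom k a b \<eta> n)"

definition well_defined :: "nat \<Rightarrow> (nat \<Rightarrow> real) \<Rightarrow> (nat \<Rightarrow> real) \<Rightarrow> (int \<Rightarrow> real) \<Rightarrow> bool" where
  "well_defined k a b \<eta> \<longleftrightarrow> (\<forall>n. denom k a b \<eta> n \<noteq> 0)"

end

theory Submission
  imports Defs
begin

text \<open>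
  Only indices in one residue class modulo \<open>4\<close> interact, so the recurrence splits into four
  independent ones, each of the form \<open>y (m + k) = y m / d m\<close> with
  \<open>d m = A m + B m * P m\<close>, where \<open>P m\<close> is the product of the \<open>k\<close> consecutive terms
  \<open>y m, ..., y (m + k - 1)\<close>. Passing from \<open>P m\<close> to \<open>P (m + 1)\<close> replaces the
  factor \<open>y m\<close> by \<open>y (m + k)\<close>, hence \<open>P (m + 1) = P m / d m\<close>: where \<open>P\<close> has no zeros,
  its reciprocal obeys a first-order affine recurrence.

  This is used without inverting \<open>P\<close>, which may vanish. Let \<open>D m\<close> be the product of
  \<open>d 0, ..., d (m - 1)\<close>. Then \<open>P m * D m = P 0\<close>, and therefore
  \<open>D (m + 1) = D m * (A m + B m * P m) = A m * D m + P 0 * B m\<close>. The solution of this affine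
  recurrence with initial value \<open>1\<close> is the expression in the numerator of the theorem
  (\<open>affine_sol_eq_prod_denominators\<close>). Consequently each quotient in the theorem is
  \<open>D m / D (m + 1) = 1 / d m\<close>, and the formula is the \<open>n\<close>-fold iteration of
  \<open>y (m + k) = y m / d m\<close> (\<open>subsequence_closed_form\<close>).
\<close>

definition affine_sol :: "(nat \<Rightarrow> 'a::comm_semiring_1) \<Rightarrow> (nat \<Rightarrow> 'a) \<Rightarrow> 'a \<Rightarrow> nat \<Rightarrow> 'a" where
  "affine_sol A B c m =
     (\<Prod>i\<in>{0..<m}. A i) + c * (\<Sum>l\<in>{0..<m}. B l * (\<Prod>i\<in>{l + 1..<m}. A i))"

lemma affine_sol_0 [simp]: "affine_sol A B c 0 = 1"
  by (simp add: affine_sol_def)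

lemma affine_sol_Suc: "affine_sol A B c (Suc m) = A m * affine_sol A B c m + c * B m"
proof -
  have "(\<Sum>l\<in>{0..<m}. B l * (\<Prod>i\<in>{l + 1..<Suc m}. A i)) =
        A m * (\<Sum>l\<in>{0..<m}. B l * (\<Prod>i\<in>{l + 1..<m}. A i))"
    unfolding sum_distrib_left by (intro sum.cong refl) (simp add: mult_ac)
  then show ?thesis
    unfolding affine_sol_def by (simp add: algebra_simps)
qed

text \<open>The window \<open>y (Suc m), ..., y (m + k)\<close> shares all but one factor with its predecessor, so
  no term of \<open>y\<close> has to be cancelled and zero terms do no harm.\<close>

lemma window_prod_Suc:
  fixes y d :: "nat \<Rightarrow> 'a::field"
  assumes "k > 0" and "y (m + k) = y m / d m"
  shows "(\<Prod>j\<in>{0..<k}. y (Suc m + j)) = (\<Prod>j\<in>{0..<k}. y (m + j)) / d m"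
proof -
  obtain k' where k: "k = Suc k'"
    using assms(1) gr0_implies_Suc by blast
  have "(\<Prod>j\<in>{0..<k}. y (Suc m + j)) = (\<Prod>j\<in>{0..<k'}. y (Suc m + j)) * y (m + k)"
    by (simp add: k)
  moreover have "(\<Prod>j\<in>{0..<k}. y (m + j)) = y m * (\<Prod>j\<in>{0..<k'}. y (Suc m + j))"
    unfolding k by (subst prod.atLeast0_lessThan_Suc_shift) simp
  ultimately show ?thesis
    using assms(2) by simp
qed

text \<open>Multiplying \<open>P (Suc m) = P m / d m\<close> out gives the invariant
  \<open>P m * (\<Prod>j\<in>{0..<m}. d j) = P 0\<close>. It replaces the varying \<open>P m\<close> in the factor \<open>d m\<close>
  by the constant \<open>P 0\<close>, which makes the recurrence for the product of the \<open>d j\<close> affine.\<close>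

lemma affine_sol_eq_prod_denominators:
  fixes A B P d :: "nat \<Rightarrow> 'a::field"
  assumes d: "\<And>m. d m = A m + B m * P m"
    and nz: "\<And>m. d m \<noteq> 0"
    and P: "\<And>m. P (Suc m) = P m / d m"
  shows "affine_sol A B (P 0) m = (\<Prod>j\<in>{0..<m}. d j)"
proof (induction m)
  case (Suc m)
  have inv: "P 0 = P m * (\<Prod>j\<in>{0..<m}. d j)"
    by (induction m) (simp_all add: P nz)
  have "affine_sol A B (P 0) (Suc m) =
        A m * (\<Prod>j\<in>{0..<m}. d j) + P m * (\<Prod>j\<in>{0..<m}. d j) * B m"
    using Suc inv by (simp add: affine_sol_Suc)
  also have "\<dots> = (\<Prod>j\<in>{0..<Suc m}. d j)"
    by (simp add: d algebra_simps)
  finally show ?case .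
qed simp

lemma subsequence_closed_form:
  fixes y A B d :: "nat \<Rightarrow> 'a::field"
  assumes "k > 0"
    and d: "\<And>m. d m = A m + B m * (\<Prod>j\<in>{0..<k}. y (m + j))"
    and nz: "\<And>m. d m \<noteq> 0"
    and rec: "\<And>m. y (m + k) = y m / d m"
  shows "y (k * n + q) = y q *
    (\<Prod>s\<in>{0..<n}. affine_sol A B (\<Prod>j\<in>{0..<k}. y j) (k * s + q)
                  / affine_sol A B (\<Prod>j\<in>{0..<k}. y j) (Suc (k * s + q)))"
proof (induction n)
  case (Suc n)
  let ?P = "\<lambda>m. \<Prod>j\<in>{0..<k}. y (m + j)"
  have window: "?P (Suc m) = ?P m / d m" for m
    using assms(1) rec by (rule window_prod_Suc)
  have sol: "affine_sol A B (\<Prod>j\<in>{0..<k}. y j) m = (\<Prod>j\<in>{0..<m}. d j)" for m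
    using affine_sol_eq_prod_denominators[of d A B ?P, OF d nz window]
    by simp
  have quot: "affine_sol A B (\<Prod>j\<in>{0..<k}. y j) m / affine_sol A B (\<Prod>j\<in>{0..<k}. y j) (Suc m)
    = 1 / d m" for m
    by (simp add: sol nz)
  have "y (k * Suc n + q) = y (k * n + q) * (1 / d (k * n + q))"
    using rec[of "k * n + q"] by (simp add: algebra_simps)
  then show ?case
    by (simp add: Suc.IH quot)
qed simp

text \<open>A residue class is enumerated as \<open>y m = \<eta> (t - 4k + 1 + 4m)\<close>, starting at an initial
  value, so that the equation for \<open>\<eta> (4m + t + 1)\<close> becomes the one for \<open>y (m + k)\<close>. Since
  the product in \<^const>\<open>denom\<close> runs backwards in \<open>\<eta>\<close>, its index is reversed: \<open>j = k - i\<close>.\<close>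

lemma denom_residue_class:
  "denom k a b \<eta> (4 * m + t) =
    a (4 * m + t) + b (4 * m + t) *
      (\<Prod>j\<in>{0..<k}. \<eta> (int t - 4 * int k + 1 + 4 * int (m + j)))"
proof -
  have "(\<Prod>i = 1..k. \<eta> (int (4 * m + t) - 4 * int i + 1)) =
        (\<Prod>j\<in>{0..<k}. \<eta> (int t - 4 * int k + 1 + 4 * int (m + j)))"
    by (rule prod.reindex_bij_witness[of _ "\<lambda>j. k - j" "\<lambda>i. k - i"])
      (auto simp: of_nat_diff algebra_simps)
  then show ?thesis
    by (simp add: denom_def)
qed

theorem mainTheorem2:
  fixes k :: nat and a b :: "nat \<Rightarrow> real" and \<eta> :: "int \<Rightarrow> real"
  assumes "k > 0"
    and "is_solution k a b \<eta>"
    and "well_defined k a b \<eta>"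
  shows "\<forall>n::nat. \<forall>i\<in>{0..4 * k - 1}.
    \<eta> (4 * int k * int n - 4 * int k + 1 + int i) =
      \<eta> (int i - 4 * int k + 1) *
      (\<Prod>s\<in>{0..<n}.
        ((\<Prod>k1\<in>{0..<k * s + i div 4}. a (4 * k1 + tau i))
          + (\<Prod>j\<in>{0..<k}. \<eta> (int (tau i) - 4 * int k + 1 + 4 * int j))
            * (\<Sum>l\<in>{0..<k * s + i div 4}. b (4 * l + tau i)
                 * (\<Prod>k2\<in>{l + 1..<k * s + i div 4}. a (4 * k2 + tau i))))
        / ((\<Prod>k1\<in>{0..k * s + i div 4}. a (4 * k1 + tau i))
          + (\<Prod>j\<in>{0..<k}. \<eta> (int (tau i) - 4 * int k + 1 + 4 * int j))
            * (\<Sum>l\<in>{0..k * s + i div 4}. b (4 * l + tau i)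
                 * (\<Prod>k2\<in>{l + 1..k * s + i div 4}. a (4 * k2 + tau i)))))"
proof (intro allI ballI)
  fix n i :: nat
  define t q where "t = tau i" and "q = i div 4"
  have i: "int i = 4 * int q + int t"
    unfolding t_def q_def tau_def by presburger
  define y where "y m = \<eta> (int t - 4 * int k + 1 + 4 * int m)" for m
  define A B d where "A m = a (4 * m + t)" and "B m = b (4 * m + t)"
    and "d m = denom k a b \<eta> (4 * m + t)" for m
  have d: "d m = A m + B m * (\<Prod>j\<in>{0..<k}. y (m + j))" for m
    using denom_residue_class[of k a b \<eta> m t] by (simp add: A_def B_def d_def y_def)
  have nz: "d m \<noteq> 0" for m
    using assms(3) by (simp add: well_defined_def d_def)
  have rec: "y (m + k) = y m / d m" for m
  proof -
    have "\<eta> (int (4 * m + t) + 1) = \<eta> (int (4 * m + t) - 4 * int k + 1) / d m"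
      using assms(2) unfolding is_solution_def d_def by blast
    then show ?thesis
      by (simp add: y_def algebra_simps)
  qed
  have "\<eta> (4 * int k * int n - 4 * int k + 1 + int i) = y (k * n + q)"
    by (simp add: y_def i algebra_simps)
  moreover have "\<eta> (int i - 4 * int k + 1) = y q"
    by (simp add: y_def i algebra_simps)
  ultimately show "\<eta> (4 * int k * int n - 4 * int k + 1 + int i) =
      \<eta> (int i - 4 * int k + 1) *
      (\<Prod>s\<in>{0..<n}.
        ((\<Prod>k1\<in>{0..<k * s + i div 4}. a (4 * k1 + tau i))
          + (\<Prod>j\<in>{0..<k}. \<eta> (int (tau i) - 4 * int k + 1 + 4 * int j))
            * (\<Sum>l\<in>{0..<k * s + i div 4}. b (4 * l + tau i)
                 * (\<Prod>k2\<in>{l + 1..<k * s + i div 4}. a (4 * k2 + tau i))))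
        / ((\<Prod>k1\<in>{0..k * s + i div 4}. a (4 * k1 + tau i))
          + (\<Prod>j\<in>{0..<k}. \<eta> (int (tau i) - 4 * int k + 1 + 4 * int j))
            * (\<Sum>l\<in>{0..k * s + i div 4}. b (4 * l + tau i)
                 * (\<Prod>k2\<in>{l + 1..k * s + i div 4}. a (4 * k2 + tau i)))))"
    using subsequence_closed_form[of k d A B y, OF assms(1) d nz rec, of n q]
    unfolding affine_sol_def A_def B_def y_def t_def q_def atLeastLessThanSuc_atLeastAtMost
    by simp
qed

end
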